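(* Let $\Sigma$ be a finite alphabet, $d=1$ and $n\ge 0$. Then every extreme point of $\mathcal{I}_n^{loc}$ is of the form $\pi_n(\mu)$, where $\mu\in\mathcal{I}$ is the uniform probability measure on a periodic orbit of the shift $\Theta$ on $\Omega=\Sigma^{\mathbb{Z}}$. In particular, $\mathcal{I}_n=\mathcal{I}_n^{loc}$.
   Context: Here $d=1$. $\Omega=\Sigma^{\mathbb{Z}}$ with the product topology and the shift action $(\Theta^u x)_v=x_{u+v}$, $u,v\in\mathbb{Z}$; a periodic orbit is a finite $\Theta$-orbit. $\mathcal{I}$ is the set of $\Theta$-invariant Borel probability measures on $\Omega$. $\Lambda_n=\{-n,\ldots,n\}$, $\Omega_n=\Sigma^{\Lambda_n}$, $\mathcal{P}_n$ is the set of probability measures on $\Omega_n$; $\pi_n:\Omega\to\Omega_n$ is the restriction map $x\mapsto x|_{\Lambda_n}$, and $\pi_n$ also denotes the induced push-forward map on probability measures. $\mathcal{I}_n=\pi_n(\mathcal{I})$. For a finite set $E\subseteq\mathbb{Z}$, $a\in\Sigma^E$ and $u\in\mathbb{Z}$, the pattern $\Theta^u a\in\Sigma^{E-u}$ is defined by $(\Theta^u a)_v=a_{v+u}$. For $E\subseteq\Lambda_n$ and $a\in\Sigma^E$, $[a]_n=\{b\in\Omega_n : b|_E=a\}$. $\mathcal{I}_n^{loc}$ is the set of locally invariant measures, i.e. of $\mu\in\mathcal{P}_n$ such that $\mu([a]_n)=\mu([\Theta^u a]_n)$ for every $E\subseteq\Lambda_n$, every $a\in\Sigma^E$ and every $u\in\mathbb{Z}$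 with $E-u\subseteq\Lambda_n$. *)

theory Defs
  imports "HOL-Probability.Probability"
begin

text \<open>
  The finite alphabet is a type \<open>'a\<close> of class \<^class>\<open>finite\<close>. Configurations are functions
  \<open>int \<Rightarrow> 'a\<close>; a pattern on \<open>E\<close> is an extensional function in \<open>E \<rightarrow>\<^sub>E UNIV\<close>.
\<close>

text \<open>
  The same function also shifts patterns: if \<open>a\<close> is extensional on \<open>E\<close>, then \<open>shift u a\<close> is
  extensional on \<open>E - u = (\<lambda>v. v - u) ` E\<close>.
\<close>

definition shift :: "int \<Rightarrow> (int \<Rightarrow> 'a) \<Rightarrow> (int \<Rightarrow> 'a)" where
  "shift u x = (\<lambda>v. x (u + v))"

definition config_topology :: "(int \<Rightarrow> 'a) topology" where
  "config_topology = product_topology (\<lambda>_. discrete_topology UNIV) UNIV"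

definition config_borel :: "(int \<Rightarrow> 'a) measure" where
  "config_borel = sigma UNIV {U. openin config_topology U}"

definition invariant_measures :: "(int \<Rightarrow> 'a) measure set" where
  "invariant_measures =
    {\<mu>. prob_space \<mu> \<and> sets \<mu> = sets config_borel \<and> (\<forall>u. distr \<mu> config_borel (shift u) = \<mu>)}"

definition periodic_orbit :: "(int \<Rightarrow> 'a) set \<Rightarrow> bool" where
  "periodic_orbit P \<longleftrightarrow> finite P \<and> (\<exists>x. P = range (\<lambda>u. shift u x))"

text \<open>\<^const>\<open>uniform_count_measure\<close> lives on \<open>P\<close>; it is transported to the Borel space.\<close>

definition uniform_on :: "(int \<Rightarrow> 'a) set \<Rightarrow> (int \<Rightarrow> 'a) measure" where
  "uniform_on P = distr (uniform_count_measure P) config_borel (\<lambda>x. x)"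

definition window :: "nat \<Rightarrow> int set" where
  "window n = {- int n..int n}"

definition window_configs :: "nat \<Rightarrow> (int \<Rightarrow> 'a) set" where
  "window_configs n = window n \<rightarrow>\<^sub>E UNIV"

definition window_measures :: "nat \<Rightarrow> (int \<Rightarrow> 'a) measure set" where
  "window_measures n = {\<mu>. prob_space \<mu> \<and> sets \<mu> = Pow (window_configs n)}"

definition marginal :: "nat \<Rightarrow> (int \<Rightarrow> 'a) measure \<Rightarrow> (int \<Rightarrow> 'a) measure" where
  "marginal n \<mu> = distr \<mu> (count_space (window_configs n)) (\<lambda>x. restrict x (window n))"

definition invariant_marginals :: "nat \<Rightarrow> (int \<Rightarrow> 'a) measure set" where
  "invariant_marginals n = marginal n ` invariant_measures"

definition cylinder :: "nat \<Rightarrow> int set \<Rightarrow> (int \<Rightarrow> 'a) \<Rightarrow> (int \<Rightarrow> 'a) set" where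
  "cylinder n E a = {b \<in> window_configs n. restrict b E = a}"

definition locally_invariant :: "nat \<Rightarrow> (int \<Rightarrow> 'a) measure set" where
  "locally_invariant n =
    {\<mu> \<in> window_measures n.
      \<forall>E \<subseteq> window n. \<forall>a \<in> E \<rightarrow>\<^sub>E UNIV. \<forall>u. (\<lambda>v. v - u) ` E \<subseteq> window n \<longrightarrow>
        measure \<mu> (cylinder n E a) = measure \<mu> (cylinder n ((\<lambda>v. v - u) ` E) (shift u a))}"

text \<open>
  The library's \<^const>\<open>extreme_point_of\<close> needs a real vector space type, which \<open>measure\<close> is not;
  this is the same notion, with convex combinations of measures taken setwise.
\<close>

definition extreme_measure_of :: "'b measure \<Rightarrow> 'b measure set \<Rightarrow> bool" where
  "extreme_measure_of \<mu> K \<longleftrightarrow> \<mu> \<in> K \<and>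
    \<not> (\<exists>\<nu>\<^sub>1 \<in> K. \<exists>\<nu>\<^sub>2 \<in> K. \<nu>\<^sub>1 \<noteq> \<nu>\<^sub>2 \<and> (\<exists>t::real. 0 < t \<and> t < 1 \<and>
        (\<forall>A \<in> sets \<mu>. measure \<mu> A = (1 - t) * measure \<nu>\<^sub>1 A + t * measure \<nu>\<^sub>2 A)))"

text \<open>
  \<^const>\<open>distr\<close> is degenerate on non-measurable maps; the following shows that the push-forwards
  above are genuine ones.
\<close>

lemma space_config_borel [simp]: "space config_borel = UNIV"
  by (simp add: config_borel_def)

lemma topspace_config_topology [simp]: "topspace config_topology = UNIV"
  by (simp add: config_topology_def)

lemma sets_config_borelI: "openin config_topology U \<Longrightarrow> U \<in> sets config_borel"
  by (simp add: config_borel_def)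

lemma measurable_shift [measurable]: "shift u \<in> measurable config_borel config_borel"
proof -
  have "continuous_map config_topology config_topology (shift u)"
    unfolding config_topology_def shift_def
    by (auto simp: continuous_map_componentwise_UNIV intro: continuous_map_product_projection)
  then have "openin config_topology (shift u -` U)" if "openin config_topology U" for U
    using that openin_continuous_map_preimage[of config_topology config_topology "shift u" U]
    by (simp add: vimage_def)
  then show ?thesis
    unfolding config_borel_def[where 'a='a]
    by (intro measurable_sigma_sets[OF sets_measure_of])
       (auto simp flip: config_borel_def intro: sets_config_borelI)
qed

lemma finite_window_configs: "finite (window_configs n :: (int \<Rightarrow> 'a::finite) set)"
  by (simp add: window_configs_def window_def finite_PiE)

lemma measurable_restrict_window:
  "(\<lambda>x. restrict x (window n)) \<in>
    measurable config_borel (count_space (window_configs n :: (int \<Rightarrow> 'a::finite) set))"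
proof (subst measurable_count_space_eq2[OF finite_window_configs], intro conjI ballI)
  show "(\<lambda>x. restrict x (window n)) \<in> space config_borel \<rightarrow> (window_configs n :: (int \<Rightarrow> 'a) set)"
    by (auto simp: window_configs_def)
next
  fix b :: "int \<Rightarrow> 'a" assume b: "b \<in> window_configs n"
  have eq: "(\<lambda>x. restrict x (window n)) -` {b} \<inter> space config_borel
      = (\<Pi>\<^sub>E v\<in>UNIV. if v \<in> window n then {b v} else UNIV)"
    using b by (auto simp: window_configs_def PiE_iff extensional_def restrict_def fun_eq_iff
        split: if_splits)
  have "finite {v. (if v \<in> window n then {b v} else UNIV) \<noteq> UNIV}"
    by (rule finite_subset[of _ "window n"]) (auto simp: window_def)
  then show "(\<lambda>x. restrict x (window n)) -` {b} \<inter> space config_borel \<in> sets config_borel"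
    unfolding eq config_topology_def
    by (intro sets_config_borelI) (auto simp: config_topology_def intro!: product_topology_basis)
qed

lemma emeasure_uniform_on:
  assumes "finite P" "A \<in> sets config_borel"
  shows "emeasure (uniform_on P) A = card (A \<inter> P) / card P"
proof -
  have "(\<lambda>x. x) \<in> measurable (uniform_count_measure P) config_borel"
    by (auto simp: measurable_def space_uniform_count_measure sets_uniform_count_measure)
  then show ?thesis
    using assms
    by (simp add: uniform_on_def emeasure_distr space_uniform_count_measure
        emeasure_uniform_count_measure)
qed

end

theory Submission imports Defs begin

text \<open>
  The words in the support of a locally invariant measure form a finite graph in which every word
  has a successor overlapping it in all but one letter. A walk in this graph eventually closes up,
  and reading off its central letters gives a periodic configuration all of whose windows lie in
  the support. Subtracting the largest possible multiple of the corresponding orbit measure and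
  renormalising yields a locally invariant measure with strictly smaller support. An extreme point
  admits no such proper splitting, and in general induction on the size of the support writes any
  locally invariant measure as a convex combination of marginals of orbit measures.
\<close>

section \<open>Window measures and marginals\<close>

lemma window_measures_measure_sum:
  fixes \<nu> :: "(int \<Rightarrow> 'a::finite) measure"
  assumes "\<nu> \<in> window_measures n" "A \<subseteq> window_configs n"
  shows "measure \<nu> A = (\<Sum>b\<in>A. measure \<nu> {b})"
proof -
  interpret prob_space \<nu> using assms by (simp add: window_measures_def)
  have "finite A" using assms finite_window_configs finite_subset by blast
  then show ?thesis
    using assms by (intro finite_measure_eq_sum_singleton) (auto simp: window_measures_def)
qed

lemma window_measures_sum_eq_1:
  fixes \<nu> :: "(int \<Rightarrow> 'a::finite) measure"
  assumes "\<nu> \<in> window_measures n"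
  shows "(\<Sum>b\<in>window_configs n. measure \<nu> {b}) = 1"
proof -
  interpret prob_space \<nu> using assms by (simp add: window_measures_def)
  have "space \<nu> = window_configs n"
    using assms by (metis (mono_tags, lifting) mem_Collect_eq sets_eq_imp_space_eq
        sets_count_space space_count_space window_measures_def)
  then show ?thesis
    using window_measures_measure_sum[OF assms order_refl] prob_space by simp
qed

lemma window_measures_eqI:
  fixes \<nu> \<nu>' :: "(int \<Rightarrow> 'a::finite) measure"
  assumes "\<nu> \<in> window_measures n" "\<nu>' \<in> window_measures n"
    and "\<And>b. b \<in> window_configs n \<Longrightarrow> measure \<nu> {b} = measure \<nu>' {b}"
  shows "\<nu> = \<nu>'"
proof (rule measure_eqI)
  show "sets \<nu> = sets \<nu>'" using assms by (simp add: window_measures_def)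
  interpret N: prob_space \<nu> using assms by (simp add: window_measures_def)
  interpret N': prob_space \<nu>' using assms by (simp add: window_measures_def)
  fix A assume "A \<in> sets \<nu>"
  then have A: "A \<subseteq> window_configs n" using assms by (simp add: window_measures_def)
  have "measure \<nu> A = measure \<nu>' A"
    unfolding window_measures_measure_sum[OF assms(1) A] window_measures_measure_sum[OF assms(2) A]
    using A assms(3) by (intro sum.cong) auto
  then show "emeasure \<nu> A = emeasure \<nu>' A"
    by (simp add: N.emeasure_eq_measure N'.emeasure_eq_measure)
qed

text \<open>Point weights are turned back into a measure, so that a renormalised remainder can be
  described by its weights alone.\<close>

lemma exists_window_measure:
  fixes w :: "(int \<Rightarrow> 'a::finite) \<Rightarrow> real"
  assumes nonneg: "\<And>b. b \<in> window_configs n \<Longrightarrow> 0 \<le> w b"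
    and total: "(\<Sum>b\<in>window_configs n. w b) = 1"
  obtains \<nu> where "\<nu> \<in> window_measures n"
    and "\<And>A. A \<subseteq> window_configs n \<Longrightarrow> measure \<nu> A = (\<Sum>b\<in>A. w b)"
proof -
  let ?\<nu> = "point_measure (window_configs n) (\<lambda>b. ennreal (w b))"
  have em: "emeasure ?\<nu> A = ennreal (\<Sum>b\<in>A. w b)" if "A \<subseteq> window_configs n" for A
  proof -
    have "emeasure ?\<nu> A = (\<Sum>b\<in>A. ennreal (w b))"
      using that by (intro emeasure_point_measure_finite finite_window_configs)
    also have "\<dots> = ennreal (\<Sum>b\<in>A. w b)" using that nonneg by (intro sum_ennreal) auto
    finally show ?thesis .
  qed
  have "prob_space ?\<nu>"
    by (intro prob_spaceI) (simp add: space_point_measure em total)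
  then have "?\<nu> \<in> window_measures n" by (simp add: window_measures_def sets_point_measure)
  moreover have "measure ?\<nu> A = (\<Sum>b\<in>A. w b)" if "A \<subseteq> window_configs n" for A
    using em[OF that] nonneg that by (intro measure_eq_emeasure_eq_ennreal sum_nonneg) auto
  ultimately show ?thesis using that by blast
qed

section \<open>Restriction of measures on the full shift to a window\<close>

lemma measurable_restrict_window_sets:
  assumes "sets \<mu> = sets (config_borel :: (int \<Rightarrow> 'a::finite) measure)"
  shows "(\<lambda>x. restrict x (window n)) \<in>
    measurable \<mu> (count_space (window_configs n :: (int \<Rightarrow> 'a) set))"
  unfolding measurable_cong_sets[OF assms refl] by (rule measurable_restrict_window)

lemma measurable_shift_sets:
  assumes "sets \<mu> = sets config_borel"
  shows "shift u \<in> measurable \<mu> config_borel"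
  unfolding measurable_cong_sets[OF assms refl] by (rule measurable_shift)

lemma marginal_in_window_measures:
  fixes \<mu> :: "(int \<Rightarrow> 'a::finite) measure"
  assumes "prob_space \<mu>" "sets \<mu> = sets config_borel"
  shows "marginal n \<mu> \<in> window_measures n"
  using assms measurable_restrict_window_sets
  by (auto simp: window_measures_def marginal_def intro!: prob_space.prob_space_distr)

lemma vimage_restrict_window_sets:
  fixes A :: "(int \<Rightarrow> 'a::finite) set"
  assumes "A \<subseteq> window_configs n"
  shows "(\<lambda>x. restrict x (window n)) -` A \<in> sets config_borel"
  using measurable_sets[OF measurable_restrict_window[of n], of A] assms by simp

lemma measure_marginal:
  fixes \<mu> :: "(int \<Rightarrow> 'a::finite) measure"
  assumes "sets \<mu> = sets config_borel" "A \<subseteq> window_configs n"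
  shows "measure (marginal n \<mu>) A = measure \<mu> ((\<lambda>x. restrict x (window n)) -` A)"
proof -
  have "space \<mu> = UNIV" using sets_eq_imp_space_eq[OF assms(1)] by simp
  then show ?thesis
    using assms measurable_restrict_window_sets[OF assms(1)]
    by (simp add: marginal_def measure_distr)
qed

lemma cylinder_subset: "cylinder n E a \<subseteq> window_configs n"
  by (auto simp: cylinder_def)

lemma vimage_restrict_cylinder:
  assumes "E \<subseteq> window n"
  shows "(\<lambda>x. restrict x (window n)) -` cylinder n E a = {x. restrict x E = a}"
  using assms by (auto simp: cylinder_def window_configs_def restrict_restrict Int_absorb1)

text \<open>Restricting a shifted configuration to the shifted set is the same as shifting its
  restriction, and \<open>shift u\<close> is injective. Hence the preimage under
  \<open>shift u\<close> of a shifted cylinder condition is the original condition.\<close>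

lemma restrict_shift_eq_iff:
  "restrict (shift u x) ((\<lambda>v. v - u) ` E) = shift u a \<longleftrightarrow> restrict x E = a"
proof -
  have "restrict (shift u x) ((\<lambda>v. v - u) ` E) = shift u (restrict x E)"
    by (auto simp: fun_eq_iff restrict_def shift_def image_iff algebra_simps
        intro: bexI[where x = "u + _"])
  moreover have "inj (shift u :: (int \<Rightarrow> 'a) \<Rightarrow> int \<Rightarrow> 'a)"
    by (rule inj_on_inverseI[where g = "shift (- u)"]) (simp add: shift_def)
  ultimately show ?thesis by (auto dest: injD)
qed

text \<open>This is the easy inclusion: the two cylinders lift to events of which one is the
  preimage of the other under \<open>shift u\<close>, so invariance gives them equal mass.\<close>

lemma marginal_locally_invariant:
  fixes \<mu> :: "(int \<Rightarrow> 'a::finite) measure"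
  assumes "\<mu> \<in> invariant_measures"
  shows "marginal n \<mu> \<in> locally_invariant n"
proof -
  have prob: "prob_space \<mu>" and sets: "sets \<mu> = sets config_borel"
    and inv: "distr \<mu> config_borel (shift u) = \<mu>" for u
    using assms by (auto simp: invariant_measures_def)
  have "measure (marginal n \<mu>) (cylinder n E a)
      = measure (marginal n \<mu>) (cylinder n ((\<lambda>v. v - u) ` E) (shift u a))"
    if E: "E \<subseteq> window n" and Eu: "(\<lambda>v. v - u) ` E \<subseteq> window n" for E u and a :: "int \<Rightarrow> 'a"
  proof -
    \<comment> \<open>The shifted cylinder, lifted to full configurations; it is measurable as the
      preimage of a set of window words.\<close>
    let ?B = "{y. restrict y ((\<lambda>v. v - u) ` E) = shift u a}"
    have B: "?B \<in> sets config_borel"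
      using vimage_restrict_window_sets[OF cylinder_subset, of n "(\<lambda>v. v - u) ` E" "shift u a"]
        vimage_restrict_cylinder[OF Eu, of "shift u a"] by simp
    have "space \<mu> = UNIV" using sets_eq_imp_space_eq[OF sets] by simp
    moreover have "shift u \<in> measurable \<mu> config_borel"
      using sets by (rule measurable_shift_sets)
    ultimately have "measure (distr \<mu> config_borel (shift u)) ?B = measure \<mu> {x. restrict x E = a}"
      using B by (simp add: measure_distr vimage_def restrict_shift_eq_iff)
    then show ?thesis
      by (simp add: measure_marginal sets cylinder_subset vimage_restrict_cylinder E Eu inv)
  qed
  then show ?thesis
    using marginal_in_window_measures[OF prob sets] by (simp add: locally_invariant_def)
qed

section \<open>Periodic orbits\<close>

lemma shift_shift: "shift u (shift v x) = shift (u + v) x"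
  by (simp add: shift_def fun_eq_iff algebra_simps)

lemma periodic_orbit_nonempty: "periodic_orbit P \<Longrightarrow> P \<noteq> {}"
  by (auto simp: periodic_orbit_def)

lemma shift_bij_betw_periodic_orbit:
  assumes "periodic_orbit P"
  shows "bij_betw (shift u) P P"
proof (rule bij_betw_byWitness[where f' = "shift (- u)"])
  obtain x where "P = range (\<lambda>u. shift u x)" using assms by (auto simp: periodic_orbit_def)
  then show "shift u ` P \<subseteq> P" "shift (- u) ` P \<subseteq> P" by (auto simp: shift_shift)
qed (simp_all add: shift_def)

text \<open>The shift permutes the orbit, so \<open>A\<close> and its preimage meet \<open>P\<close>
  in equally many points.\<close>

lemma uniform_on_invariant:
  fixes P :: "(int \<Rightarrow> 'a::finite) set"
  assumes "periodic_orbit P"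
  shows "uniform_on P \<in> invariant_measures"
proof -
  have fin: "finite P" using assms by (simp add: periodic_orbit_def)
  have sets: "sets (uniform_on P) = sets config_borel" by (simp add: uniform_on_def)
  have space: "space (uniform_on P) = UNIV" by (simp add: uniform_on_def)
  have "card P > 0" using fin periodic_orbit_nonempty[OF assms] by (simp add: card_gt_0_iff)
  then have "emeasure (uniform_on P) (space (uniform_on P)) = 1"
    using emeasure_uniform_on[OF fin, of UNIV] sets.top[of config_borel] unfolding space
    by simp
  then have "prob_space (uniform_on P)" by (rule prob_spaceI)
  moreover have "distr (uniform_on P) config_borel (shift u) = uniform_on P" for u
  proof (rule measure_eqI)
    fix A assume "A \<in> sets (distr (uniform_on P) config_borel (shift u))"
    then have A: "A \<in> sets config_borel" by simp
    have "shift u \<in> measurable (uniform_on P) config_borel"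
      using sets by (rule measurable_shift_sets)
    then have "emeasure (distr (uniform_on P) config_borel (shift u)) A
        = card (shift u -` A \<inter> P) / card P"
      using A measurable_sets[OF measurable_shift A, of u]
      by (simp add: emeasure_distr space emeasure_uniform_on fin)
    also have "card (shift u -` A \<inter> P) = card (A \<inter> P)"
    proof (rule bij_betw_same_card)
      have image: "shift u ` (shift u -` A \<inter> P) = A \<inter> shift u ` P" by auto
      have surj: "shift u ` P = P"
        using shift_bij_betw_periodic_orbit[OF assms] by (simp add: bij_betw_def)
      show "bij_betw (shift u) (shift u -` A \<inter> P) (A \<inter> P)"
        by (rule bij_betw_subset[OF shift_bij_betw_periodic_orbit[OF assms]])
          (use surj image in auto)
    qed
    finally show "emeasure (distr (uniform_on P) config_borel (shift u)) A = emeasure (uniform_on P) A"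
      using A by (simp add: emeasure_uniform_on fin)
  qed (simp add: sets)
  ultimately show ?thesis using sets by (simp add: invariant_measures_def)
qed

text \<open>Charged words are windows of orbit points; this places the support of an orbit marginal
  inside that of \<nu> later on.\<close>

lemma measure_marginal_uniform_on_pos:
  fixes P :: "(int \<Rightarrow> 'a::finite) set"
  assumes "finite P" "b \<in> window_configs n" "measure (marginal n (uniform_on P)) {b} > 0"
  obtains y where "y \<in> P" "restrict y (window n) = b"
proof -
  have "measure (uniform_on P) ((\<lambda>x. restrict x (window n)) -` {b}) > 0"
    using assms measure_marginal[of "uniform_on P" "{b}" n] by (simp add: uniform_on_def)
  then have "emeasure (uniform_on P) ((\<lambda>x. restrict x (window n)) -` {b}) \<noteq> 0"
    by (auto simp: measure_def)
  then have "card ((\<lambda>x. restrict x (window n)) -` {b} \<inter> P) \<noteq> 0"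
    using emeasure_uniform_on[OF assms(1) vimage_restrict_window_sets, of "{b}" n] assms(2)
    by auto
  then obtain y where "y \<in> (\<lambda>x. restrict x (window n)) -` {b} \<inter> P" by (metis card.empty ex_in_conv)
  then show ?thesis using that by auto
qed

section \<open>Periodic sequences and cycles of maps on finite sets\<close>

lemma finite_range_periodic:
  fixes x :: "int \<Rightarrow> 'a"
  assumes "0 < p" "\<And>k. x (k + p) = x k"
  shows "finite (range (\<lambda>u. shift u x))"
proof -
  have nat: "x (k + int m * p) = x k" for k m
    by (induction m) (use assms(2)[of "k + int _ * p"] in \<open>auto simp: algebra_simps\<close>)
  have per: "x (k + j * p) = x k" for k j
  proof (cases "0 \<le> j")
    case True
    then show ?thesis using nat[of k "nat j"] by simp
  next
    case False
    \<comment> \<open>A negative multiple is undone by adding \<open>nat (- j)\<close> periods,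
      which reduces it to the case already shown.\<close>
    then have "k + j * p + int (nat (- j)) * p = k" by simp
    then show ?thesis using nat[of "k + j * p" "nat (- j)"] by argo
  qed
  have "shift u x = shift (u mod p) x" for u
  proof
    fix v
    have "u + v = (u mod p + v) + (u div p) * p" by (simp add: algebra_simps)
    then show "shift u x v = shift (u mod p) x v" unfolding shift_def by (metis per)
  qed
  then have "range (\<lambda>u. shift u x) \<subseteq> (\<lambda>u. shift u x) ` {0..<p}"
    using assms(1) by (intro image_subsetI image_eqI[where x = "_ mod p"]) auto
  then show ?thesis by (rule finite_subset) simp
qed

text \<open>By the pigeonhole principle an orbit of \<open>f\<close> repeats. Indexing the resulting
  cycle by all integers makes it a two-sided walk although \<open>f\<close> need not be
  invertible.\<close>

lemma finite_set_map_cycle: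
  assumes "finite S" "S \<noteq> {}" "f ` S \<subseteq> S"
  obtains g :: "int \<Rightarrow> 'b" and p where "0 < p" "range g \<subseteq> S" "\<And>k. g (k + 1) = f (g k)"
    "\<And>k. g (k + p) = g k"
proof -
  obtain b0 where "b0 \<in> S" using assms by auto
  have S: "(f ^^ i) b0 \<in> S" for i by (induction i) (use \<open>b0 \<in> S\<close> assms in auto)
  then have "finite (range (\<lambda>i. (f ^^ i) b0))"
    using assms(1) by (meson finite_subset image_subsetI)
  then have "\<not> inj (\<lambda>i. (f ^^ i) b0)" using finite_imageD infinite_UNIV_nat by blast
  then obtain i j where ij: "i < j" "(f ^^ i) b0 = (f ^^ j) b0"
    by (auto simp: inj_def) (metis linorder_neqE_nat)
  \<comment> \<open>The starting point is moved to the first of two equal iterates, where the orbit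
    already lies on the cycle; \<open>p\<close> is a return time.\<close>
  define b where "b = (f ^^ i) b0"
  define p where "p = int (j - i)"
  have p: "0 < p" using ij by (simp add: p_def)
  have close: "(f ^^ nat p) b = b"
    using ij by (metis add.commute b_def comp_apply funpow_add le_add_diff_inverse less_imp_le
        nat_int p_def)
  define g where "g k = (f ^^ nat (k mod p)) b" for k
  have "g (k + 1) = f (g k)" for k
  \<comment> \<open>Only residue \<open>p - 1\<close> wraps around, and there \<open>close\<close>
    is what identifies the next iterate with \<open>b\<close>.\<close>
  proof (cases "k mod p + 1 = p")
    case True
    then have "(k + 1) mod p = 0" by (metis mod_add_left_eq mod_self)
    moreover have "nat p = Suc (nat (k mod p))" using True p pos_mod_sign[OF p, of k] by linarith
    ultimately show ?thesis using close by (simp add: g_def)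
  next
    case False
    then have "k mod p + 1 < p" using pos_mod_bound[OF p, of k] by linarith
    then have "(k + 1) mod p = k mod p + 1"
      using pos_mod_sign[OF p, of k] by (metis add.commute add_increasing mod_add_right_eq
          mod_pos_pos_trivial zero_le_one)
    then show ?thesis using pos_mod_sign[OF p, of k] by (simp add: g_def nat_add_distrib)
  qed
  moreover have "range g \<subseteq> S"
    using S by (auto simp: g_def b_def simp flip: funpow_add[THEN fun_cong, unfolded comp_def])
  moreover have "g (k + p) = g k" for k by (simp add: g_def)
  ultimately show ?thesis using that p by blast
qed

section \<open>Splitting off an orbit measure\<close>

text \<open>Local invariance with \<open>u = 1\<close> says that the last letters of
  \<open>b\<close> are as likely to occur one place further left. That event then has positive mass,
  hence contains a charged word.\<close>

lemma locally_invariant_successor: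
  fixes \<nu> :: "(int \<Rightarrow> 'a::finite) measure"
  assumes \<nu>: "\<nu> \<in> locally_invariant n" and b: "b \<in> window_configs n" "measure \<nu> {b} > 0"
  obtains c where "c \<in> window_configs n" "measure \<nu> {c} > 0"
    "\<And>v. v \<in> window n \<Longrightarrow> v + 1 \<in> window n \<Longrightarrow> c v = b (v + 1)"
proof -
  \<comment> \<open>The window without its left end; shifted, it is the window without its right
    end. For \<open>n = 0\<close> it is empty and both cylinders are the whole space.\<close>
  define E where "E = {- int n + 1..int n}"
  define a where "a = restrict b E"
  define D where "D = cylinder n ((\<lambda>v. v - 1) ` E) (shift 1 a)"
  have \<nu>w: "\<nu> \<in> window_measures n" using \<nu> by (simp add: locally_invariant_def)
  interpret prob_space \<nu> using \<nu>w by (simp add: window_measures_def)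
  have E: "E \<subseteq> window n" "(\<lambda>v. v - 1) ` E \<subseteq> window n" by (auto simp: E_def window_def)
  have "a \<in> E \<rightarrow>\<^sub>E UNIV" by (simp add: a_def)
  then have "measure \<nu> (cylinder n E a) = measure \<nu> D"
    using \<nu> E unfolding locally_invariant_def D_def by blast
  moreover have "measure \<nu> {b} \<le> measure \<nu> (cylinder n E a)"
    using \<nu>w b by (intro finite_measure_mono)
      (auto simp: cylinder_def a_def window_measures_def)
  ultimately have "measure \<nu> D > 0" using b by linarith
  then have "(\<Sum>c\<in>D. measure \<nu> {c}) > 0"
    using window_measures_measure_sum[OF \<nu>w cylinder_subset, of "(\<lambda>v. v - 1) ` E" "shift 1 a"]
    by (simp add: D_def)
  then obtain c where c: "c \<in> D" "measure \<nu> {c} > 0"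
    using sum_nonpos[of D "\<lambda>c. measure \<nu> {c}"] by (metis linorder_not_less)
  show ?thesis
  proof
    show "c \<in> window_configs n" using c cylinder_subset by (auto simp: D_def)
    show "measure \<nu> {c} > 0" by fact
    fix v assume v: "v \<in> window n" "v + 1 \<in> window n"
    then have E: "v + 1 \<in> E" "v \<in> (\<lambda>v. v - 1) ` E"
      by (auto simp: E_def window_def intro!: image_eqI[where x = "v + 1"])
    have "restrict c ((\<lambda>v. v - 1) ` E) = shift 1 a" using c(1) by (simp add: D_def cylinder_def)
    then have "c v = shift 1 a v" using E(2) by (metis restrict_apply')
    then show "c v = b (v + 1)" using E by (simp add: shift_def a_def add.commute)
  qed
qed

text \<open>Choosing one successor for each charged word gives a self-map of a finite set. A cycle
  of this map, read at the centre of the window, spells out the periodic configuration.\<close>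

lemma periodic_orbit_in_support:
  fixes \<nu> :: "(int \<Rightarrow> 'a::finite) measure"
  assumes \<nu>: "\<nu> \<in> locally_invariant n"
  obtains P where "periodic_orbit P" "\<And>y. y \<in> P \<Longrightarrow> measure \<nu> {restrict y (window n)} > 0"
proof -
  define S where "S = {b \<in> window_configs n. measure \<nu> {b} > 0}"
  have \<nu>w: "\<nu> \<in> window_measures n" using \<nu> by (simp add: locally_invariant_def)
  have "S \<noteq> {}"
  proof
    assume "S = {}"
    then have "(\<Sum>b\<in>window_configs n. measure \<nu> {b}) \<le> 0"
      by (intro sum_nonpos) (auto simp: S_def not_less)
    then show False using window_measures_sum_eq_1[OF \<nu>w] by simp
  qed
  have "\<forall>b\<in>S. \<exists>c. c \<in> S \<and> (\<forall>v. v \<in> window n \<and> v + 1 \<in> window n \<longrightarrow> c v = b (v + 1))"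
  proof
    fix b assume "b \<in> S"
    then have "b \<in> window_configs n" "measure \<nu> {b} > 0" by (auto simp: S_def)
    then obtain c where "c \<in> window_configs n" "measure \<nu> {c} > 0"
      "\<And>v. v \<in> window n \<Longrightarrow> v + 1 \<in> window n \<Longrightarrow> c v = b (v + 1)"
      by (rule locally_invariant_successor[OF \<nu>]) blast
    then show "\<exists>c. c \<in> S \<and> (\<forall>v. v \<in> window n \<and> v + 1 \<in> window n \<longrightarrow> c v = b (v + 1))"
      unfolding S_def by blast
  qed
  from bchoice[OF this] obtain f where "\<forall>b\<in>S. f b \<in> S \<and>
      (\<forall>v. v \<in> window n \<and> v + 1 \<in> window n \<longrightarrow> f b v = b (v + 1))"
    by blast
  then have f: "f ` S \<subseteq> S"
    "\<And>b v. b \<in> S \<Longrightarrow> v \<in> window n \<Longrightarrow> v + 1 \<in> window n \<Longrightarrow> f b v = b (v + 1)"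
    by blast+
  have "finite S" by (simp add: S_def finite_window_configs)
  obtain g :: "int \<Rightarrow> int \<Rightarrow> 'a" and p where g: "0 < p" "range g \<subseteq> S"
    "\<And>k. g (k + 1) = f (g k)" "\<And>k. g (k + p) = g k"
    by (rule finite_set_map_cycle[OF \<open>finite S\<close> \<open>S \<noteq> {}\<close> f(1)]) (rule that)
  have step: "g (k + 1) v = g k (v + 1)" if "v \<in> window n" "v + 1 \<in> window n" for k v
    using f(2)[of "g k" v] that g(2) by (auto simp: g(3))
  \<comment> \<open>By the overlap, one place to the right in a word is the same as one step ahead
    in the walk. So every letter of a word is the central letter of another word of the
    walk.\<close>
  have pos: "int m \<le> int n \<Longrightarrow> g k (int m) = g (k + int m) 0" for k m
  proof (induction m arbitrary: k)
    case (Suc m)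
    have "g k (int m + 1) = g (k + 1) (int m)"
      using Suc.prems by (intro step[symmetric]) (auto simp: window_def)
    then show ?case using Suc by (simp add: algebra_simps)
  qed simp
  have neg: "int m \<le> int n \<Longrightarrow> g k (- int m) = g (k - int m) 0" for k m
  proof (induction m arbitrary: k)
    case (Suc m)
    \<comment> \<open>To move left, the overlap is applied to the preceding word
      \<open>g (k - 1)\<close>.\<close>
    have "g (k - 1 + 1) (- 1 - int m) = g (k - 1) (- 1 - int m + 1)"
      using Suc.prems by (intro step) (auto simp: window_def)
    then show ?case using Suc by (simp add: algebra_simps)
  qed simp
  have center: "g k v = g (k + v) 0" if "v \<in> window n" for k v
    by (cases "0 \<le> v") (use that pos[of "nat v" k] neg[of "nat (- v)" k] in \<open>auto simp: window_def\<close>)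
  define x where "x k = g k 0" for k
  \<comment> \<open>The windows of \<open>x\<close> are exactly the words of the walk, hence all
    charged by \<nu>.\<close>
  have restr: "restrict (shift u x) (window n) = g u" for u
  proof
    fix v
    have "g u \<in> window_configs n" using g(2) by (auto simp: S_def)
    then show "restrict (shift u x) (window n) v = g u v"
      using center[of v u]
      by (cases "v \<in> window n") (auto simp: shift_def x_def window_configs_def PiE_def extensional_def)
  qed
  show ?thesis
  proof
    show "periodic_orbit (range (\<lambda>u. shift u x))"
      using finite_range_periodic[of p x] g by (auto simp: periodic_orbit_def x_def)
    show "measure \<nu> {restrict y (window n)} > 0" if "y \<in> range (\<lambda>u. shift u x)" for y
      using that g(2) by (auto simp: restr S_def)
  qed
qed

section \<open>Subtracting a multiple of an orbit marginal and renormalising\<close>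

text \<open>The equations of local invariance are linear, so they survive the subtraction; the bound
  \<open>le\<close> keeps the weights nonnegative, and division by \<open>1 - t\<close> restores
  total mass one.\<close>

lemma locally_invariant_subtract:
  fixes \<nu> \<pi> :: "(int \<Rightarrow> 'a::finite) measure"
  assumes \<nu>: "\<nu> \<in> locally_invariant n" and \<pi>: "\<pi> \<in> locally_invariant n"
    and t: "t < 1" and le: "\<And>b. b \<in> window_configs n \<Longrightarrow> t * measure \<pi> {b} \<le> measure \<nu> {b}"
  obtains \<nu>' where "\<nu>' \<in> locally_invariant n"
    and "\<And>A. A \<subseteq> window_configs n \<Longrightarrow> measure \<nu> A = (1 - t) * measure \<nu>' A + t * measure \<pi> A"
proof -
  have w: "\<nu> \<in> window_measures n" "\<pi> \<in> window_measures n"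
    using \<nu> \<pi> by (simp_all add: locally_invariant_def)
  let ?w = "\<lambda>b. (measure \<nu> {b} - t * measure \<pi> {b}) / (1 - t)"
  have sum: "(\<Sum>b\<in>A. ?w b) = (measure \<nu> A - t * measure \<pi> A) / (1 - t)"
    if "A \<subseteq> window_configs n" for A
    using window_measures_measure_sum[OF w(1) that] window_measures_measure_sum[OF w(2) that]
    by (simp add: sum_subtractf sum_distrib_left flip: sum_divide_distrib)
  have "(\<Sum>b\<in>window_configs n. ?w b) = 1"
    using t window_measures_sum_eq_1[OF w(1)] window_measures_sum_eq_1[OF w(2)]
    by (simp add: sum_subtractf flip: sum_divide_distrib sum_distrib_left)
  then obtain \<nu>' where \<nu>': "\<nu>' \<in> window_measures n"
    and "\<And>A. A \<subseteq> window_configs n \<Longrightarrow> measure \<nu>' A = (\<Sum>b\<in>A. ?w b)"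
    using exists_window_measure[of n ?w] le t by auto
  then have m: "measure \<nu>' A = (measure \<nu> A - t * measure \<pi> A) / (1 - t)"
    if "A \<subseteq> window_configs n" for A
    using sum that by simp
  show ?thesis
  proof
    show "\<nu>' \<in> locally_invariant n"
      using \<nu> \<pi> \<nu>' unfolding locally_invariant_def by (auto simp: m cylinder_subset)
    show "measure \<nu> A = (1 - t) * measure \<nu>' A + t * measure \<pi> A" if "A \<subseteq> window_configs n" for A
      using m[OF that] t by (simp add: field_simps)
  qed
qed

text \<open>Removing as much of the orbit marginal as fits either exhausts \<nu> or leaves a
  remainder that misses a word of the support. The strict inclusion drives the induction and also
  rules out trivial splittings of extreme points.\<close>

lemma locally_invariant_split:
  fixes \<nu> :: "(int \<Rightarrow> 'a::finite) measure"
  assumes \<nu>: "\<nu> \<in> locally_invariant n"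
  obtains P where "periodic_orbit P" "\<nu> = marginal n (uniform_on P)"
  | P \<nu>' t where "periodic_orbit P" "\<nu>' \<in> locally_invariant n" "0 < t" "t < 1"
    "\<And>A. A \<subseteq> window_configs n \<Longrightarrow>
      measure \<nu> A = (1 - t) * measure \<nu>' A + t * measure (marginal n (uniform_on P)) A"
    "{b \<in> window_configs n. 0 < measure \<nu>' {b}} \<subset> {b \<in> window_configs n. 0 < measure \<nu> {b}}"
proof -
  let ?W = "window_configs n :: (int \<Rightarrow> 'a) set"
  obtain P where P: "periodic_orbit P" "\<And>y. y \<in> P \<Longrightarrow> measure \<nu> {restrict y (window n)} > 0"
    using periodic_orbit_in_support[OF \<nu>] by blast
  define \<pi> where "\<pi> = marginal n (uniform_on P)"
  have \<pi>: "\<pi> \<in> locally_invariant n"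
    unfolding \<pi>_def by (intro marginal_locally_invariant uniform_on_invariant P)
  have w: "\<nu> \<in> window_measures n" "\<pi> \<in> window_measures n"
    using \<nu> \<pi> by (simp_all add: locally_invariant_def)
  have supp: "measure \<nu> {b} > 0" if "b \<in> ?W" "measure \<pi> {b} > 0" for b
  proof -
    have "finite P" using P by (simp add: periodic_orbit_def)
    then show ?thesis
      using measure_marginal_uniform_on_pos that P(2) unfolding \<pi>_def by metis
  qed
  define Q where "Q = {b \<in> ?W. measure \<pi> {b} > 0}"
  have Q: "finite Q" by (simp add: Q_def finite_window_configs)
  have "Q \<noteq> {}"
  proof
    assume "Q = {}"
    then have "(\<Sum>b\<in>?W. measure \<pi> {b}) \<le> 0" by (intro sum_nonpos) (auto simp: Q_def not_less)
    then show False using window_measures_sum_eq_1[OF w(2)] by simp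
  qed
  \<comment> \<open>The largest factor for which \<open>t\<close> times \<pi> stays below \<nu>;
    words outside \<open>Q\<close> impose no constraint.\<close>
  define t where "t = Min ((\<lambda>b. measure \<nu> {b} / measure \<pi> {b}) ` Q)"
  have "t \<in> (\<lambda>b. measure \<nu> {b} / measure \<pi> {b}) ` Q"
    unfolding t_def using Q \<open>Q \<noteq> {}\<close> by (intro Min_in) auto
  then obtain b0 where b0: "b0 \<in> Q" "t = measure \<nu> {b0} / measure \<pi> {b0}" by blast
  have t0: "0 < t" using b0 supp by (auto simp: Q_def)
  have le: "t * measure \<pi> {b} \<le> measure \<nu> {b}" if "b \<in> ?W" for b
  proof (cases "b \<in> Q")
    case True
    then have "t \<le> measure \<nu> {b} / measure \<pi> {b}" unfolding t_def using Q by (intro Min_le) auto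
    then show ?thesis using True by (simp add: Q_def pos_le_divide_eq)
  next
    case False
    then have "measure \<pi> {b} = 0"
      using that by (auto simp: Q_def not_less intro: antisym)
    then show ?thesis by simp
  qed
  show ?thesis
  proof (cases "t < 1")
    case True
    then obtain \<nu>' where \<nu>': "\<nu>' \<in> locally_invariant n"
      and eq: "\<And>A. A \<subseteq> ?W \<Longrightarrow> measure \<nu> A = (1 - t) * measure \<nu>' A + t * measure \<pi> A"
      using locally_invariant_subtract[OF \<nu> \<pi> _ le] by metis
    have "0 < measure \<nu> {b}" if "b \<in> ?W" "0 < measure \<nu>' {b}" for b
      using eq[of "{b}"] that True t0 by (simp add: add_pos_nonneg)
    moreover have "b0 \<in> ?W" "0 < measure \<nu> {b0}" using b0 supp by (auto simp: Q_def)
    \<comment> \<open>At the minimiser \<open>b0\<close> the multiple of \<pi> uses up all the mass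
      of \<nu>.\<close>
    moreover have "measure \<nu>' {b0} = 0"
      using eq[of "{b0}"] b0 True by (auto simp: Q_def)
    ultimately have "{b \<in> ?W. 0 < measure \<nu>' {b}} \<subset> {b \<in> ?W. 0 < measure \<nu> {b}}" by force
    then show ?thesis using that(2) P(1) \<nu>' t0 True eq unfolding \<pi>_def by blast
  next
    \<comment> \<open>Here \<pi> lies below \<nu> at every word, and since both have total mass one
      they coincide.\<close>
    case False
    then have ge: "measure \<pi> {b} \<le> measure \<nu> {b}" if "b \<in> ?W" for b
      using le[OF that] mult_right_mono[of 1 t "measure \<pi> {b}"] by simp
    have "(\<Sum>b\<in>?W. measure \<nu> {b} - measure \<pi> {b}) = 0"
      using window_measures_sum_eq_1[OF w(1)] window_measures_sum_eq_1[OF w(2)]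
      by (simp add: sum_subtractf)
    then have "measure \<nu> {b} = measure \<pi> {b}" if "b \<in> ?W" for b
      using sum_nonneg_eq_0_iff[OF finite_window_configs, of n "\<lambda>b. measure \<nu> {b} - measure \<pi> {b}"]
        ge that by simp
    then have "\<nu> = \<pi>" using window_measures_eqI[OF w] by blast
    then show ?thesis using that(1) P(1) unfolding \<pi>_def by blast
  qed
qed

section \<open>Convex combinations of measures\<close>

text \<open>The mixture is realised as a two-stage experiment: a coin with success probability
  \<open>t\<close> selects \<open>N\<close> or \<open>M\<close>, from which a point is then
  drawn.\<close>

lemma exists_convex_combination_measure:
  assumes "prob_space M" "prob_space N" "sets M = sets N" "0 \<le> t" "t \<le> (1::real)"
  obtains K where "prob_space K" "sets K = sets N"
    and "\<And>A. A \<in> sets N \<Longrightarrow> measure K A = (1 - t) * measure M A + t * measure N A"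
proof -
  interpret M: prob_space M by fact
  interpret N: prob_space N by fact
  let ?f = "\<lambda>c. if c then N else M"
  let ?K = "measure_pmf (bernoulli_pmf t) \<bind> ?f"
  have f: "?f \<in> measurable (measure_pmf (bernoulli_pmf t)) (subprob_algebra N)"
    using assms by (auto simp: measurable_pmf_measure1 space_subprob_algebra
        M.prob_space_axioms prob_space_imp_subprob_space)
  have em: "emeasure ?K A = ennreal ((1 - t) * measure M A + t * measure N A)" if "A \<in> sets N" for A
  proof -
    have "emeasure ?K A = (\<integral>\<^sup>+ c. emeasure (?f c) A \<partial>measure_pmf (bernoulli_pmf t))"
      by (intro emeasure_bind[OF _ f that]) simp
    also have "\<dots> = emeasure N A * ennreal t + emeasure M A * ennreal (1 - t)"
      using assms(4,5) by simp
    also have "\<dots> = ennreal ((1 - t) * measure M A + t * measure N A)"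
      using assms(4,5) by (simp add: M.emeasure_eq_measure N.emeasure_eq_measure ennreal_mult
          add.commute mult.commute)
    finally show ?thesis .
  qed
  have sets: "sets ?K = sets N" using f by (intro sets_bind[where N = N]) (auto simp: assms)
  then have sp: "space ?K = space N" by (rule sets_eq_imp_space_eq)
  have "space M = space N" by (rule sets_eq_imp_space_eq) fact
  then have "prob_space ?K"
    using em[of "space N"] N.prob_space M.prob_space by (intro prob_spaceI) (simp add: sp)
  moreover have "measure ?K A = (1 - t) * measure M A + t * measure N A" if "A \<in> sets N" for A
    using em[OF that] assms(4,5) by (intro measure_eq_emeasure_eq_ennreal) auto
  ultimately show ?thesis using that sets by blast
qed

text \<open>Push-forward under the shift is affine, so a mixture of fixed points is again
  fixed.\<close>

lemma exists_invariant_convex_combination: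
  fixes \<mu> \<mu>' :: "(int \<Rightarrow> 'a::finite) measure"
  assumes \<mu>: "\<mu> \<in> invariant_measures" and \<mu>': "\<mu>' \<in> invariant_measures" and t: "0 \<le> t" "t \<le> 1"
  obtains \<kappa> where "\<kappa> \<in> invariant_measures"
    and "\<And>A. A \<in> sets config_borel \<Longrightarrow> measure \<kappa> A = (1 - t) * measure \<mu> A + t * measure \<mu>' A"
proof -
  have sets: "sets \<mu> = sets config_borel" "sets \<mu>' = sets config_borel"
    and prob: "prob_space \<mu>" "prob_space \<mu>'"
    using \<mu> \<mu>' by (simp_all add: invariant_measures_def)
  obtain \<kappa> where K: "prob_space \<kappa>" "sets \<kappa> = sets config_borel"
    and eq: "\<And>A. A \<in> sets config_borel \<Longrightarrow> measure \<kappa> A = (1 - t) * measure \<mu> A + t * measure \<mu>' A"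
    using exists_convex_combination_measure[OF prob _ t] sets by metis
  interpret K: prob_space \<kappa> by fact
  have preim: "measure (distr M config_borel (shift u)) A = measure M (shift u -` A)"
    if "sets M = sets config_borel" "A \<in> sets config_borel" for M u and A :: "(int \<Rightarrow> 'a) set"
  proof -
    have "space M = UNIV" using sets_eq_imp_space_eq[OF that(1)] by simp
    moreover have "shift u \<in> measurable M config_borel"
      using that(1) by (rule measurable_shift_sets)
    ultimately show ?thesis using that by (simp add: measure_distr)
  qed
  have "distr \<kappa> config_borel (shift u) = \<kappa>" for u
  proof (rule measure_eqI)
    have "shift u \<in> measurable \<kappa> config_borel" using K(2) by (rule measurable_shift_sets)
    then interpret D: prob_space "distr \<kappa> config_borel (shift u)" by (rule K.prob_space_distr)
    fix A assume "A \<in> sets (distr \<kappa> config_borel (shift u))"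
    then have A: "A \<in> sets config_borel" by simp
    have "shift u -` A \<in> sets config_borel" using measurable_sets[OF measurable_shift A, of u] by simp
    then have "measure (distr \<kappa> config_borel (shift u)) A =
        (1 - t) * measure (distr \<mu> config_borel (shift u)) A
        + t * measure (distr \<mu>' config_borel (shift u)) A"
      by (simp add: preim K(2) A eq sets)
    also have "\<dots> = measure \<kappa> A"
      using \<mu> \<mu>' A by (simp add: invariant_measures_def eq)
    finally show "emeasure (distr \<kappa> config_borel (shift u)) A = emeasure \<kappa> A"
      by (simp add: D.emeasure_eq_measure K.emeasure_eq_measure)
  qed (simp add: K)
  then show ?thesis using that[of \<kappa>] K eq by (simp add: invariant_measures_def)
qed

section \<open>Extension to invariant measures, and the form of the extreme points\<close>

text \<open>Strong induction on the number of charged words: the remainder of the splitting has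
  fewer, hence extends to an invariant measure, and mixing this with the orbit measure extends
  \<nu>.\<close>

lemma locally_invariant_is_marginal:
  fixes \<nu> :: "(int \<Rightarrow> 'a::finite) measure"
  assumes "\<nu> \<in> locally_invariant n"
  shows "\<nu> \<in> invariant_marginals n"
  using assms
proof (induction "card {b \<in> window_configs n. 0 < measure \<nu> {b}}" arbitrary: \<nu> rule: less_induct)
  case less
  from less.prems show ?case
  proof (cases rule: locally_invariant_split)
    case (1 P)
    then show ?thesis using uniform_on_invariant[of P] by (auto simp: invariant_marginals_def)
  next
    case (2 P \<nu>' t)
    have "finite {b \<in> window_configs n :: (int \<Rightarrow> 'a) set. 0 < measure \<nu> {b}}"
      by (simp add: finite_window_configs)
    then have "\<nu>' \<in> invariant_marginals n"
      using less.hyps[of \<nu>'] 2 psubset_card_mono by blast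
    then obtain \<mu>' where \<mu>': "\<mu>' \<in> invariant_measures" "\<nu>' = marginal n \<mu>'"
      by (auto simp: invariant_marginals_def)
    have \<mu>: "uniform_on P \<in> invariant_measures" by (rule uniform_on_invariant) fact
    obtain \<kappa> where \<kappa>: "\<kappa> \<in> invariant_measures" and eq: "\<And>A. A \<in> sets config_borel \<Longrightarrow>
        measure \<kappa> A = (1 - t) * measure \<mu>' A + t * measure (uniform_on P) A"
      using exists_invariant_convex_combination[OF \<mu>'(1) \<mu>, of t] 2 by (metis less_imp_le)
    have "\<nu> = marginal n \<kappa>"
    proof (rule window_measures_eqI)
      show "\<nu> \<in> window_measures n" using less.prems by (simp add: locally_invariant_def)
      show "marginal n \<kappa> \<in> window_measures n"
        using marginal_locally_invariant[OF \<kappa>] by (simp add: locally_invariant_def)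
      fix b :: "int \<Rightarrow> 'a" assume b: "b \<in> window_configs n"
      have sets: "sets \<kappa> = sets config_borel" "sets \<mu>' = sets config_borel"
        "sets (uniform_on P) = sets config_borel"
        using \<kappa> \<mu>' \<mu> by (simp_all add: invariant_measures_def)
      show "measure \<nu> {b} = measure (marginal n \<kappa>) {b}"
        using b 2(5)[of "{b}"] vimage_restrict_window_sets[of "{b}" n]
        by (simp add: \<mu>' measure_marginal sets eq)
    qed
    then show ?thesis using \<kappa> by (auto simp: invariant_marginals_def)
  qed
qed

lemma extreme_locally_invariant:
  fixes \<nu> :: "(int \<Rightarrow> 'a::finite) measure"
  assumes "extreme_measure_of \<nu> (locally_invariant n)"
  obtains P where "periodic_orbit P" "\<nu> = marginal n (uniform_on P)"
proof -
  have "\<nu> \<in> locally_invariant n" using assms by (simp add: extreme_measure_of_def)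
  then show ?thesis
  proof (cases rule: locally_invariant_split)
    case (1 P)
    then show ?thesis using that by blast
  next
    case (2 P \<nu>' t)
    let ?\<pi> = "marginal n (uniform_on P)"
    have \<pi>: "?\<pi> \<in> locally_invariant n"
      by (intro marginal_locally_invariant uniform_on_invariant) fact
    have \<nu>: "\<nu> \<in> window_measures n" using assms
      by (simp add: extreme_measure_of_def locally_invariant_def)
    then have "\<forall>A\<in>sets \<nu>. measure \<nu> A = (1 - t) * measure \<nu>' A + t * measure ?\<pi> A"
      using 2(5) by (simp add: window_measures_def)
    \<comment> \<open>Distinct components would form a proper convex combination, which extremality
      forbids.\<close>
    then have "\<nu>' = ?\<pi>" using assms 2(2-4) \<pi> unfolding extreme_measure_of_def by blast
    \<comment> \<open>With equal components \<nu> agrees with \<nu>' on all words, contradicting the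
      strictly smaller support of \<nu>'. So only the orbit case remains.\<close>
    then have "measure \<nu> {b} = measure \<nu>' {b}" if "b \<in> window_configs n" for b
      using 2(5)[of "{b}"] that by (simp add: algebra_simps)
    then show ?thesis using 2(6) by auto
  qed
qed

theorem theorem2:
  fixes n :: nat
  shows "(\<forall>\<nu> :: (int \<Rightarrow> 'a::finite) measure. extreme_measure_of \<nu> (locally_invariant n) \<longrightarrow>
            (\<exists>\<mu> \<in> invariant_measures. \<exists>P. periodic_orbit P \<and> \<mu> = uniform_on P \<and> \<nu> = marginal n \<mu>))
       \<and> (invariant_marginals n :: (int \<Rightarrow> 'a) measure set) = locally_invariant n"
proof (intro conjI allI impI)
  fix \<nu> :: "(int \<Rightarrow> 'a) measure"
  assume "extreme_measure_of \<nu> (locally_invariant n)"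
  then obtain P where "periodic_orbit P" "\<nu> = marginal n (uniform_on P)"
    by (rule extreme_locally_invariant)
  then show "\<exists>\<mu>\<in>invariant_measures. \<exists>P. periodic_orbit P \<and> \<mu> = uniform_on P \<and> \<nu> = marginal n \<mu>"
    using uniform_on_invariant by blast
next
  show "(invariant_marginals n :: (int \<Rightarrow> 'a) measure set) = locally_invariant n"
    using locally_invariant_is_marginal marginal_locally_invariant
    by (auto simp: invariant_marginals_def)
qed

end
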